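(* (High SNR slope without jamming.) Let $0<\alpha<1$, $0<\eta<1$, $\beta=\frac{1-\alpha}{2\eta\alpha}$, $\xi>0$, and let $p_R\in[0,1]$ be a constant (the power outage probability at the relay). Let $X,Y$ be independent exponential random variables with means $m_x,m_y>0$. For $\rho>0$ define $$\gamma_R=\rho(\xi X+Y),\qquad \gamma_{S_2}=\frac{\xi\rho XY}{Y+\beta},\qquad\gamma_{S_1}=\frac{\rho XY}{X+\beta},$$ $$\bar R_{Sec}^{WoJ}(\rho)=(1-p_R)\,\mathbb E\left\{\left[\frac{1-\alpha}{2}\log_2\frac{(1+\gamma_{S_1})(1+\gamma_{S_2})}{1+\gamma_R}\right]^+\right\}.$$ Then the high SNR slope is $$S_\infty^{WoJ}:=\lim_{\rho\to\infty}\frac{\bar R_{Sec}^{WoJ}(\rho)}{\log_2\rho}=(1-p_R)\frac{1-\alpha}{2}.$$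
   Context: $[x]^+=\max(x,0)$. In the model, two sources with transmit powers $P_1=\xi P_2$ communicate through an untrusted energy-harvesting relay; $\rho=P_2/N_0$ is the transmit SNR ($N_0$ the noise power); $X,Y$ are the channel power gains from sources 1, 2 to the relay; $\bar R_{Sec}^{WoJ}$ is the ergodic secrecy sum rate without jamming. *)

theory Defs
  imports "HOL-Probability.Probability"
begin

definition pos_part :: "real \<Rightarrow> real" where
  "pos_part x = max x 0"

definition beta :: "real \<Rightarrow> real \<Rightarrow> real" where
  "beta \<alpha> \<eta> = (1 - \<alpha>) / (2 * \<eta> * \<alpha>)"

text \<open>
  Signal-to-noise ratios at the relay, at source 2 and at source 1.
  \<open>\<rho>\<close> is the transmit SNR, \<open>\<xi>\<close> the ratio of the sources' transmit powers, and
  \<open>x\<close>, \<open>y\<close> are the channel power gains from source 1 and from source 2 to the relay.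
\<close>

definition gamma_R :: "real \<Rightarrow> real \<Rightarrow> real \<Rightarrow> real \<Rightarrow> real" where
  "gamma_R \<xi> \<rho> x y = \<rho> * (\<xi> * x + y)"

definition gamma_S2 :: "real \<Rightarrow> real \<Rightarrow> real \<Rightarrow> real \<Rightarrow> real \<Rightarrow> real" where
  "gamma_S2 \<xi> b \<rho> x y = \<xi> * \<rho> * x * y / (y + b)"

definition gamma_S1 :: "real \<Rightarrow> real \<Rightarrow> real \<Rightarrow> real \<Rightarrow> real" where
  "gamma_S1 b \<rho> x y = \<rho> * x * y / (x + b)"

definition secrecy_sum_rate_WoJ :: "real \<Rightarrow> real \<Rightarrow> real \<Rightarrow> real \<Rightarrow> real \<Rightarrow> real \<Rightarrow> real" where
  "secrecy_sum_rate_WoJ \<alpha> \<eta> \<xi> \<rho> x y =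
     pos_part ((1 - \<alpha>) / 2 *
       log 2 ((1 + gamma_S1 (beta \<alpha> \<eta>) \<rho> x y) * (1 + gamma_S2 \<xi> (beta \<alpha> \<eta>) \<rho> x y)
              / (1 + gamma_R \<xi> \<rho> x y)))"

definition ergodic_secrecy_sum_rate_WoJ ::
  "'a measure \<Rightarrow> ('a \<Rightarrow> real) \<Rightarrow> ('a \<Rightarrow> real) \<Rightarrow> real \<Rightarrow> real \<Rightarrow> real \<Rightarrow> real \<Rightarrow> real \<Rightarrow> real" where
  "ergodic_secrecy_sum_rate_WoJ M X Y p\<^sub>R \<alpha> \<eta> \<xi> \<rho> =
     (1 - p\<^sub>R) * (\<integral>\<omega>. secrecy_sum_rate_WoJ \<alpha> \<eta> \<xi> \<rho> (X \<omega>) (Y \<omega>) \<partial>M)"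

end

theory Submission
  imports Defs "HOL-Real_Asymp.Real_Asymp"
begin

text \<open>
  Almost surely the gains are positive; then the argument of the logarithm grows like a constant
  times \<open>\<rho>\<close>, so the normalised rate tends to \<open>(1 - \<alpha>) / 2\<close> pointwise. Since
  \<open>\<gamma>\<^sub>S\<^sub>2 \<le> \<gamma>\<^sub>R\<close> and \<open>\<gamma>\<^sub>S\<^sub>1 \<le> \<rho> y\<close>, that argument is at most \<open>1 + \<rho> y \<le> \<rho> (1 + y)\<close>, which
  yields an integrable bound, and dominated convergence applies.
\<close>

lemma exponential_distributed_AE_pos:
  assumes "distributed M lborel X (\<lambda>x. ennreal (exponential_density l x))"
  shows "AE \<omega> in M. 0 < X \<omega>"
proof -
  \<comment> \<open>The density vanishes on the negative half-line but may be positive at 0 itself,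
    so the null set {0} is discarded to get strict positivity.\<close>
  have "AE x in lborel. 0 < ennreal (exponential_density l x) \<longrightarrow> 0 < x"
    using AE_lborel_singleton[of "0::real"]
    by eventually_elim (auto simp: exponential_density_def split: if_splits)
  then have "AE x in distr M lborel X. 0 < x"
    unfolding distributed_distr_eq_density[OF assms]
    by (subst AE_density) (rule distributed_borel_measurable[OF assms])
  then show ?thesis
    by (rule AE_distrD[OF distributed_measurable[OF assms]])
qed

text \<open>The Bochner integral of a non-integrable function is 0 by convention, so the nonzero
  expectation \<open>1 / l\<close> already forces integrability.\<close>

lemma (in prob_space) exponential_distributed_integrable:
  assumes "0 < l" "distributed M lborel X (exponential_density l)"
  shows "integrable M X"
  using exponential_distributed_expectation[OF assms] assms(1)
    not_integrable_integral_eq[of M X] by auto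

lemma secrecy_sum_rate_WoJ_normalized_tendsto:
  assumes "0 < beta \<alpha> \<eta>" "\<alpha> < 1" "0 < \<xi>" "0 < x" "0 < y"
  shows "((\<lambda>\<rho>. secrecy_sum_rate_WoJ \<alpha> \<eta> \<xi> \<rho> x y / log 2 \<rho>) \<longlongrightarrow> (1 - \<alpha>) / 2) at_top"
proof -
  define a where "a = x * y / (x + beta \<alpha> \<eta>)"
  define c where "c = \<xi> * x * y / (y + beta \<alpha> \<eta>)"
  define d where "d = \<xi> * x + y"
  define k where "k = (1 - \<alpha>) / 2"
  have pos: "0 < a" "0 < c" "0 < d" "0 < k"
    using assms by (auto simp: a_def c_def d_def k_def intro!: divide_pos_pos add_pos_pos mult_pos_pos)
  \<comment> \<open>For fixed gains the three SNRs are linear in \<rho> with slopes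
    \<open>a\<close>, \<open>c\<close> and \<open>d\<close>, so the quotient is asymptotic to (a c /
    d) \<rho>. The constant a c / d contributes a bounded term that disappears after division by
    \<open>log 2 \<rho>\<close>, and as \<open>k\<close> is positive the maximum with 0 eventually
    has no effect.\<close>
  have "((\<lambda>\<rho>. max (k * log 2 ((1 + \<rho> * a) * (1 + \<rho> * c) / (1 + \<rho> * d))) 0 / log 2 \<rho>) \<longlongrightarrow> k) at_top"
    using pos by real_asymp
  then show ?thesis
    by (simp add: secrecy_sum_rate_WoJ_def pos_part_def gamma_R_def gamma_S1_def gamma_S2_def
        a_def c_def d_def k_def mult_ac)
qed

text \<open>The threshold 2 is the base of the logarithm: from there on \<open>log 2 \<rho>\<close>
  is at least 1, so the summand \<open>y / ln 2\<close> can be absorbed into a multiple of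
  \<open>log 2 \<rho>\<close>. The resulting bound is free of \<rho> and affine in
  \<open>y\<close>.\<close>

lemma secrecy_sum_rate_WoJ_normalized_bound:
  assumes "0 < beta \<alpha> \<eta>" "\<alpha> < 1" "0 < \<xi>" "0 < x" "0 < y" "2 \<le> \<rho>"
  shows "\<bar>secrecy_sum_rate_WoJ \<alpha> \<eta> \<xi> \<rho> x y / log 2 \<rho>\<bar> \<le> (1 - \<alpha>) / 2 * (1 + y / ln 2)"
proof -
  let ?b = "beta \<alpha> \<eta>"
  let ?S1 = "gamma_S1 ?b \<rho> x y" and ?S2 = "gamma_S2 \<xi> ?b \<rho> x y" and ?R = "gamma_R \<xi> \<rho> x y"
  define L where "L = log 2 ((1 + ?S1) * (1 + ?S2) / (1 + ?R))"
  have L\<rho>: "1 \<le> log 2 \<rho>"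
    using assms by (simp add: le_log_iff)
  have S1: "0 \<le> ?S1" "?S1 \<le> \<rho> * y"
    using assms by (auto simp: gamma_S1_def field_simps)
  have "?S2 \<le> \<xi> * \<rho> * x"
    using assms by (auto simp: gamma_S2_def field_simps)
  also have "\<dots> \<le> ?R"
    using assms by (simp add: gamma_R_def algebra_simps)
  finally have S2: "0 \<le> ?S2" "?S2 \<le> ?R"
    using assms by (auto simp: gamma_S2_def)
  \<comment> \<open>The relay term cancels one source: \<open>?S2 \<le> ?R\<close> makes (1 +
    \<open>?S2\<close>) / (1 + \<open>?R\<close>) at most 1.\<close>
  have "(1 + ?S1) * (1 + ?S2) / (1 + ?R) \<le> 1 + ?S1"
    using S1 S2 by (auto simp: divide_le_eq intro!: mult_left_mono)
  also have "\<dots> \<le> \<rho> * (1 + y)"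
    using S1 assms by (simp add: algebra_simps)
  finally have "L \<le> log 2 (\<rho> * (1 + y))"
    unfolding L_def using S1 S2 assms by (subst log_le_cancel_iff) auto
  also have "\<dots> = log 2 \<rho> + ln (1 + y) / ln 2"
    using assms by (simp add: log_mult_pos) (simp add: log_def)
  also have "\<dots> \<le> log 2 \<rho> + y / ln 2"
    using assms ln_add_one_self_le_self[of y] by (simp add: divide_right_mono)
  also have "\<dots> \<le> log 2 \<rho> * (1 + y / ln 2)"
    using L\<rho> assms mult_right_mono[of 1 "log 2 \<rho>" "y / ln 2"] by (simp add: distrib_left)
  finally have "L \<le> log 2 \<rho> * (1 + y / ln 2)" .
  then have "(1 - \<alpha>) / 2 * L \<le> (1 - \<alpha>) / 2 * (log 2 \<rho> * (1 + y / ln 2))"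
    using assms by (intro mult_left_mono) auto
  \<comment> \<open>The rate is a maximum with 0, so its upper bound must dominate 0 as
    well.\<close>
  moreover have "0 \<le> (1 - \<alpha>) / 2 * (log 2 \<rho> * (1 + y / ln 2))"
    using assms L\<rho> by (intro mult_nonneg_nonneg add_nonneg_nonneg) auto
  ultimately have "secrecy_sum_rate_WoJ \<alpha> \<eta> \<xi> \<rho> x y \<le> (1 - \<alpha>) / 2 * (1 + y / ln 2) * log 2 \<rho>"
    by (simp add: secrecy_sum_rate_WoJ_def pos_part_def L_def mult_ac)
  moreover have "0 \<le> secrecy_sum_rate_WoJ \<alpha> \<eta> \<xi> \<rho> x y"
    by (simp add: secrecy_sum_rate_WoJ_def pos_part_def)
  ultimately show ?thesis
    using L\<rho> by (simp add: divide_le_eq)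
qed

theorem mainTheorem5:
  fixes M :: "'a measure"
    and X Y :: "'a \<Rightarrow> real"
    and \<alpha> \<eta> \<xi> p\<^sub>R m\<^sub>x m\<^sub>y :: real
  assumes "prob_space M"
    and "0 < \<alpha>" "\<alpha> < 1"
    and "0 < \<eta>" "\<eta> < 1"
    and "0 < \<xi>"
    and "0 \<le> p\<^sub>R" "p\<^sub>R \<le> 1"
    and "0 < m\<^sub>x" "0 < m\<^sub>y"
    and "distributed M lborel X (\<lambda>x. ennreal (exponential_density (1 / m\<^sub>x) x))"
    and "distributed M lborel Y (\<lambda>y. ennreal (exponential_density (1 / m\<^sub>y) y))"
    and "prob_space.indep_var M borel X borel Y"
  shows "((\<lambda>\<rho>. ergodic_secrecy_sum_rate_WoJ M X Y p\<^sub>R \<alpha> \<eta> \<xi> \<rho> / log 2 \<rho>)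
           \<longlongrightarrow> (1 - p\<^sub>R) * ((1 - \<alpha>) / 2)) at_top"
proof -
  interpret prob_space M by fact
  note distX = assms(11) and distY = assms(12)
  have [measurable]: "X \<in> borel_measurable M" "Y \<in> borel_measurable M"
    using distributed_measurable[OF distX] distributed_measurable[OF distY] by simp_all
  have b: "0 < beta \<alpha> \<eta>"
    using assms by (simp add: beta_def)
  have pos: "AE \<omega> in M. 0 < X \<omega> \<and> 0 < Y \<omega>"
    using exponential_distributed_AE_pos[OF distX] exponential_distributed_AE_pos[OF distY]
    by eventually_elim simp
  have intY: "integrable M Y"
    using exponential_distributed_integrable[of "1 / m\<^sub>y" Y] distY \<open>0 < m\<^sub>y\<close> by simp
  let ?f = "\<lambda>\<rho> \<omega>. secrecy_sum_rate_WoJ \<alpha> \<eta> \<xi> \<rho> (X \<omega>) (Y \<omega>) / log 2 \<rho>"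
  have "((\<lambda>\<rho>. \<integral>\<omega>. ?f \<rho> \<omega> \<partial>M) \<longlongrightarrow> (\<integral>\<omega>. (1 - \<alpha>) / 2 \<partial>M)) at_top"
  proof (rule integral_dominated_convergence_at_top)
    show "?f \<rho> \<in> borel_measurable M" for \<rho>
      unfolding secrecy_sum_rate_WoJ_def pos_part_def gamma_R_def gamma_S1_def gamma_S2_def
      by measurable
    show "integrable M (\<lambda>\<omega>. (1 - \<alpha>) / 2 * (1 + Y \<omega> / ln 2))"
      using intY by simp
    show "\<forall>\<^sub>F \<rho> in at_top. AE \<omega> in M. norm (?f \<rho> \<omega>) \<le> (1 - \<alpha>) / 2 * (1 + Y \<omega> / ln 2)"
      using eventually_ge_at_top[of 2]
    proof eventually_elim
      case (elim \<rho>)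
      show ?case
        using pos by eventually_elim
          (use secrecy_sum_rate_WoJ_normalized_bound b assms elim in auto)
    qed
    show "AE \<omega> in M. ((\<lambda>\<rho>. ?f \<rho> \<omega>) \<longlongrightarrow> (1 - \<alpha>) / 2) at_top"
      using pos by eventually_elim
        (use secrecy_sum_rate_WoJ_normalized_tendsto b assms in auto)
  qed simp
  \<comment> \<open>The limit integrand is constant and \<open>M\<close> has total mass 1, so its
    integral is that constant.\<close>
  then have "((\<lambda>\<rho>. (1 - p\<^sub>R) * (\<integral>\<omega>. ?f \<rho> \<omega> \<partial>M)) \<longlongrightarrow> (1 - p\<^sub>R) * ((1 - \<alpha>) / 2)) at_top"
    by (intro tendsto_mult_left) (simp add: prob_space)
  then show ?thesis
    by (simp add: ergodic_secrecy_sum_rate_WoJ_def)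
qed

end
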